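(* Every $EMV$-algebra $M$ is either an $MV$-algebra or $M$ can be embedded into an $MV$-algebra $N$ as a maximal ideal of $N$ (i.e., there are an $MV$-algebra $N$ and an injective $EMV$-homomorphism $M\to N$ whose image is a maximal ideal of $N$).
   Context: An algebra $(M;\vee,\wedge,\oplus,0)$ of type $(2,2,2,0)$ is an $EMV$-algebra if: (1) $(M;\vee,\wedge,0)$ is a distributive lattice with least element $0$; (2) $(M;\oplus,0)$ is a commutative ordered monoid with neutral element $0$; (3) writing $\mathcal I(M)=\{a\in M: a\oplus a=a\}$, for all $a\le b$ in $\mathcal I(M)$ and all $x\in[a,b]$ the element $\lambda_{a,b}(x)=\min\{z\in[a,b]: x\oplus z=b\}$ exists in $M$, and $([a,b];\oplus,\lambda_{a,b},a,b)$ is an $MV$-algebra; (4) each $x\in M$ lies below some $a\in\mathcal I(M)$. We write $\lambda_b:=\lambda_{0,b}$. Every $MV$-algebra is regarded as an $EMV$-algebra with its lattice operations, $\oplus$ and $0$; saying that an $EMV$-algebra $M$ is an $MV$-algebra means that it has a top element $1$, in which case $(M;\oplus,\lambda_1,0,1)$ is an $MV$-algebra. An $EMV$-homomorphism is a map $f$ preserving $\vee,\wedge,\oplus,0$ with $f(\lambda_b(x))=\lambda_{f(b)}(f(x))$ for all idempotents $b$ and $x\in[0,b]$. An ideal of an $MV$-algebra is a non-empty down-closed subset closed under $\oplus$; maximal ideals are maximal among proper ideals. *)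

theory Defs
  imports "HOL-Algebra.Group"
begin

section \<open>MV-algebras\<close>

record 'a mv = "'a partial_object" +
  mv_plus :: "'a \<Rightarrow> 'a \<Rightarrow> 'a"
  mv_neg :: "'a \<Rightarrow> 'a"
  mv_zero :: 'a
  mv_one :: 'a

text \<open>Degenerate MV-algebras, with 0 = 1, are allowed.\<close>

locale mv_algebra =
  fixes A :: "('a, 'm) mv_scheme"
  assumes plus_monoid:
      "comm_monoid \<lparr>carrier = carrier A, monoid.mult = mv_plus A, one = mv_zero A\<rparr>"
    and neg_closed: "x \<in> carrier A \<Longrightarrow> mv_neg A x \<in> carrier A"
    and one_closed: "mv_one A \<in> carrier A"
    and neg_zero: "mv_neg A (mv_zero A) = mv_one A"
    and neg_neg: "x \<in> carrier A \<Longrightarrow> mv_neg A (mv_neg A x) = x"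
    and plus_one: "x \<in> carrier A \<Longrightarrow> mv_plus A x (mv_one A) = mv_one A"
    and lukasiewicz: "\<lbrakk>x \<in> carrier A; y \<in> carrier A\<rbrakk> \<Longrightarrow>
      mv_plus A (mv_neg A (mv_plus A (mv_neg A x) y)) y =
      mv_plus A (mv_neg A (mv_plus A (mv_neg A y) x)) x"

definition mv_sup :: "('a, 'm) mv_scheme \<Rightarrow> 'a \<Rightarrow> 'a \<Rightarrow> 'a" where
  "mv_sup A x y = mv_plus A (mv_neg A (mv_plus A (mv_neg A x) y)) y"

definition mv_inf :: "('a, 'm) mv_scheme \<Rightarrow> 'a \<Rightarrow> 'a \<Rightarrow> 'a" where
  "mv_inf A x y = mv_neg A (mv_sup A (mv_neg A x) (mv_neg A y))"

section \<open>EMV-algebras\<close>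

record 'a emv = "'a partial_object" +
  emv_sup :: "'a \<Rightarrow> 'a \<Rightarrow> 'a"
  emv_inf :: "'a \<Rightarrow> 'a \<Rightarrow> 'a"
  emv_plus :: "'a \<Rightarrow> 'a \<Rightarrow> 'a"
  emv_zero :: 'a

definition emv_order :: "('a, 'm) emv_scheme \<Rightarrow> 'a gorder" where
  "emv_order M = \<lparr>carrier = carrier M, eq = (=), le = (\<lambda>x y. emv_inf M x y = x)\<rparr>"

abbreviation emv_le :: "('a, 'm) emv_scheme \<Rightarrow> 'a \<Rightarrow> 'a \<Rightarrow> bool" where
  "emv_le M x y \<equiv> x \<sqsubseteq>\<^bsub>emv_order M\<^esub> y"

abbreviation emv_interval :: "('a, 'm) emv_scheme \<Rightarrow> 'a \<Rightarrow> 'a \<Rightarrow> 'a set" where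
  "emv_interval M a b \<equiv> \<lbrace>a..b\<rbrace>\<^bsub>emv_order M\<^esub>"

definition emv_idempotents :: "('a, 'm) emv_scheme \<Rightarrow> 'a set" where
  "emv_idempotents M = {a \<in> carrier M. emv_plus M a a = a}"

text \<open>The element \<open>\<lambda>\<^sub>a\<^sub>,\<^sub>b(x)\<close>; meaningful only where the minimum exists, which the
  locale \<open>emv_algebra\<close> below demands separately.\<close>

definition emv_lam :: "('a, 'm) emv_scheme \<Rightarrow> 'a \<Rightarrow> 'a \<Rightarrow> 'a \<Rightarrow> 'a" where
  "emv_lam M a b x =
    (THE l. least (emv_order M) l {z \<in> emv_interval M a b. emv_plus M x z = b})"

definition interval_mv :: "('a, 'm) emv_scheme \<Rightarrow> 'a \<Rightarrow> 'a \<Rightarrow> 'a mv" where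
  "interval_mv M a b =
    \<lparr>carrier = emv_interval M a b, mv_plus = emv_plus M, mv_neg = emv_lam M a b,
     mv_zero = a, mv_one = b\<rparr>"

locale emv_algebra =
  fixes M :: "('a, 'm) emv_scheme"
  assumes sup_closed: "\<lbrakk>x \<in> carrier M; y \<in> carrier M\<rbrakk> \<Longrightarrow> emv_sup M x y \<in> carrier M"
    and inf_closed: "\<lbrakk>x \<in> carrier M; y \<in> carrier M\<rbrakk> \<Longrightarrow> emv_inf M x y \<in> carrier M"
    and sup_assoc: "\<lbrakk>x \<in> carrier M; y \<in> carrier M; z \<in> carrier M\<rbrakk> \<Longrightarrow>
      emv_sup M (emv_sup M x y) z = emv_sup M x (emv_sup M y z)"
    and inf_assoc: "\<lbrakk>x \<in> carrier M; y \<in> carrier M; z \<in> carrier M\<rbrakk> \<Longrightarrow>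
      emv_inf M (emv_inf M x y) z = emv_inf M x (emv_inf M y z)"
    and sup_commute: "\<lbrakk>x \<in> carrier M; y \<in> carrier M\<rbrakk> \<Longrightarrow> emv_sup M x y = emv_sup M y x"
    and inf_commute: "\<lbrakk>x \<in> carrier M; y \<in> carrier M\<rbrakk> \<Longrightarrow> emv_inf M x y = emv_inf M y x"
    and sup_absorb: "\<lbrakk>x \<in> carrier M; y \<in> carrier M\<rbrakk> \<Longrightarrow> emv_sup M x (emv_inf M x y) = x"
    and inf_absorb: "\<lbrakk>x \<in> carrier M; y \<in> carrier M\<rbrakk> \<Longrightarrow> emv_inf M x (emv_sup M x y) = x"
    and distrib: "\<lbrakk>x \<in> carrier M; y \<in> carrier M; z \<in> carrier M\<rbrakk> \<Longrightarrow>
      emv_inf M x (emv_sup M y z) = emv_sup M (emv_inf M x y) (emv_inf M x z)"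
    and zero_least: "least (emv_order M) (emv_zero M) (carrier M)"
    and plus_monoid:
      "comm_monoid \<lparr>carrier = carrier M, monoid.mult = emv_plus M, one = emv_zero M\<rparr>"
    and plus_mono: "\<lbrakk>x \<in> carrier M; y \<in> carrier M; z \<in> carrier M; emv_le M x y\<rbrakk> \<Longrightarrow>
      emv_le M (emv_plus M x z) (emv_plus M y z)"
    and lam_exists: "\<lbrakk>a \<in> emv_idempotents M; b \<in> emv_idempotents M; emv_le M a b;
        x \<in> emv_interval M a b\<rbrakk> \<Longrightarrow>
      \<exists>l. least (emv_order M) l {z \<in> emv_interval M a b. emv_plus M x z = b}"
    and interval_mv_algebra:
      "\<lbrakk>a \<in> emv_idempotents M; b \<in> emv_idempotents M; emv_le M a b\<rbrakk> \<Longrightarrow>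
      mv_algebra (interval_mv M a b)"
    and below_idempotent: "x \<in> carrier M \<Longrightarrow> \<exists>a \<in> emv_idempotents M. emv_le M x a"

text \<open>An EMV-algebra is an MV-algebra if it has a top element. That
  \<open>(M; \<oplus>, \<lambda>\<^sub>1, 0, 1)\<close> is then an MV-algebra follows, but is recorded here as well.\<close>

definition emv_is_mv :: "('a, 'm) emv_scheme \<Rightarrow> bool" where
  "emv_is_mv M \<longleftrightarrow>
    (\<exists>t. greatest (emv_order M) t (carrier M) \<and>
      mv_algebra \<lparr>carrier = carrier M, mv_plus = emv_plus M,
        mv_neg = emv_lam M (emv_zero M) t, mv_zero = emv_zero M, mv_one = t\<rparr>)"

definition emv_of_mv :: "('a, 'm) mv_scheme \<Rightarrow> 'a emv" where
  "emv_of_mv A =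
    \<lparr>carrier = carrier A, emv_sup = mv_sup A, emv_inf = mv_inf A,
     emv_plus = mv_plus A, emv_zero = mv_zero A\<rparr>"

definition emv_hom :: "('a, 'm) emv_scheme \<Rightarrow> ('b, 'n) emv_scheme \<Rightarrow> ('a \<Rightarrow> 'b) set" where
  "emv_hom M N = {f \<in> carrier M \<rightarrow> carrier N.
    (\<forall>x \<in> carrier M. \<forall>y \<in> carrier M.
      f (emv_sup M x y) = emv_sup N (f x) (f y) \<and>
      f (emv_inf M x y) = emv_inf N (f x) (f y) \<and>
      f (emv_plus M x y) = emv_plus N (f x) (f y)) \<and>
    f (emv_zero M) = emv_zero N \<and>
    (\<forall>b \<in> emv_idempotents M. \<forall>x \<in> emv_interval M (emv_zero M) b.
      f (emv_lam M (emv_zero M) b x) = emv_lam N (emv_zero N) (f b) (f x))}"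

section \<open>Ideals of MV-algebras\<close>

definition mv_ideal :: "('a, 'm) mv_scheme \<Rightarrow> 'a set \<Rightarrow> bool" where
  "mv_ideal A I \<longleftrightarrow> I \<subseteq> carrier A \<and> I \<noteq> {} \<and>
    (\<forall>x \<in> I. \<forall>y \<in> carrier A. emv_le (emv_of_mv A) y x \<longrightarrow> y \<in> I) \<and>
    (\<forall>x \<in> I. \<forall>y \<in> I. mv_plus A x y \<in> I)"

definition mv_maximal_ideal :: "('a, 'm) mv_scheme \<Rightarrow> 'a set \<Rightarrow> bool" where
  "mv_maximal_ideal A I \<longleftrightarrow> mv_ideal A I \<and> I \<noteq> carrier A \<and>
    (\<forall>J. mv_ideal A J \<longrightarrow> J \<noteq> carrier A \<longrightarrow> I \<subseteq> J \<longrightarrow> J = I)"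

end

theory Submission
  imports Defs
begin

text \<open>Adjoin to \<open>M\<close> a formal complement \<open>Inr x\<close> of every element \<open>x\<close>. For an idempotent \<open>b\<close>
  above \<open>x\<close>, evaluate \<open>Inl x\<close> as \<open>x\<close> and \<open>Inr x\<close> as \<open>\<lambda>\<^sub>b(x)\<close> in the MV-algebra \<open>[0,b]\<close>. The
  pointwise sum of two such evaluations is again an evaluation, because the residual
  \<open>\<lambda>\<^sub>b(u \<oplus> v)\<close> does not depend on \<open>b\<close> as soon as \<open>u\<close> or \<open>v\<close> is a formal complement. If \<open>M\<close> has no
  top element, an element is determined by its evaluations at all large \<open>b\<close>, so the equations of
  MV-algebras pass from the intervals \<open>[0,b]\<close> to the enlarged algebra.\<close>

section \<open>The order of an MV-algebra\<close>

context mv_algebra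
begin

abbreviation plus_syn (infixl "\<oplus>" 65) where "x \<oplus> y \<equiv> mv_plus A x y"
abbreviation neg_syn ("\<sim> _" [81] 80) where "\<sim> x \<equiv> mv_neg A x"
abbreviation zero_syn ("\<zero>") where "\<zero> \<equiv> mv_zero A"
abbreviation one_syn ("\<one>") where "\<one> \<equiv> mv_one A"

text \<open>The natural order in equational form, so that order claims become rewriting with
  \<open>\<oplus>\<close> and \<open>\<sim>\<close>. Inside an EMV-algebra,
  \<open>interval_below_iff\<close> identifies it with the lattice order.\<close>

definition below (infix "\<preceq>" 50) where "x \<preceq> y \<longleftrightarrow> \<sim> x \<oplus> y = \<one>"

lemma plus_closed [simp, intro]: "x \<in> carrier A \<Longrightarrow> y \<in> carrier A \<Longrightarrow> x \<oplus> y \<in> carrier A"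
  using comm_monoid.axioms(1)[OF plus_monoid, THEN monoid.m_closed] by simp

lemma zero_closed [simp, intro]: "\<zero> \<in> carrier A"
  using comm_monoid.axioms(1)[OF plus_monoid, THEN monoid.one_closed] by simp

lemma plus_assoc:
  "x \<in> carrier A \<Longrightarrow> y \<in> carrier A \<Longrightarrow> z \<in> carrier A \<Longrightarrow> x \<oplus> y \<oplus> z = x \<oplus> (y \<oplus> z)"
  using comm_monoid.axioms(1)[OF plus_monoid, THEN monoid.m_assoc] by simp

lemma plus_commute: "x \<in> carrier A \<Longrightarrow> y \<in> carrier A \<Longrightarrow> x \<oplus> y = y \<oplus> x"
  using comm_monoid.m_comm[OF plus_monoid] by simp

lemma plus_left_commute:
  "x \<in> carrier A \<Longrightarrow> y \<in> carrier A \<Longrightarrow> z \<in> carrier A \<Longrightarrow> x \<oplus> (y \<oplus> z) = y \<oplus> (x \<oplus> z)"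
  by (metis plus_assoc plus_commute)

lemmas plus_ac = plus_assoc plus_commute plus_left_commute

lemma plus_zero [simp]: "x \<in> carrier A \<Longrightarrow> x \<oplus> \<zero> = x"
  using comm_monoid.axioms(1)[OF plus_monoid, THEN monoid.r_one] by simp

lemma zero_plus [simp]: "x \<in> carrier A \<Longrightarrow> \<zero> \<oplus> x = x"
  using comm_monoid.axioms(1)[OF plus_monoid, THEN monoid.l_one] by simp

declare neg_closed [simp, intro] one_closed [simp, intro] neg_zero [simp] neg_neg [simp]
  plus_one [simp]

lemma one_plus [simp]: "x \<in> carrier A \<Longrightarrow> \<one> \<oplus> x = \<one>"
  by (metis one_closed plus_commute plus_one)

lemma neg_one [simp]: "\<sim> \<one> = \<zero>"
  by (metis neg_neg neg_zero zero_closed)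

text \<open>At \<open>y = \<one>\<close> the left side of the Lukasiewicz axiom collapses to
  \<open>\<one>\<close> and the right side to \<open>\<sim> x \<oplus> x\<close>.\<close>

lemma neg_plus_self [simp]: "x \<in> carrier A \<Longrightarrow> \<sim> x \<oplus> x = \<one>"
  using lukasiewicz[of x \<one>] by simp

lemma plus_neg_self [simp]: "x \<in> carrier A \<Longrightarrow> x \<oplus> \<sim> x = \<one>"
  using plus_commute[of x "\<sim> x"] by simp

lemma below_iff_plus:
  assumes "x \<in> carrier A" "y \<in> carrier A"
  shows "x \<preceq> y \<longleftrightarrow> (\<exists>w \<in> carrier A. y = x \<oplus> w)"
proof
  assume "x \<preceq> y"
  \<comment> \<open>One side of the Lukasiewicz axiom reduces to \<open>y\<close>. The witness
    \<open>\<sim> (\<sim> y \<oplus> x)\<close> is the truncated difference of \<open>y\<close> and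
    \<open>x\<close>.\<close>
  then have "y = x \<oplus> \<sim> (\<sim> y \<oplus> x)"
    using lukasiewicz[OF assms] assms by (simp add: below_def plus_commute)
  then show "\<exists>w \<in> carrier A. y = x \<oplus> w" using assms by blast
next
  assume "\<exists>w \<in> carrier A. y = x \<oplus> w"
  then show "x \<preceq> y" using assms by (auto simp: below_def plus_assoc[symmetric])
qed

lemma below_refl: "x \<in> carrier A \<Longrightarrow> x \<preceq> x"
  by (simp add: below_def)

lemma below_plus: "x \<in> carrier A \<Longrightarrow> y \<in> carrier A \<Longrightarrow> x \<preceq> x \<oplus> y"
  by (auto simp: below_iff_plus)

lemma below_antisym: "x \<preceq> y \<Longrightarrow> y \<preceq> x \<Longrightarrow> x \<in> carrier A \<Longrightarrow> y \<in> carrier A \<Longrightarrow> x = y"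
  using lukasiewicz[of x y] by (simp add: below_def)

lemma below_one: "x \<in> carrier A \<Longrightarrow> x \<preceq> \<one>"
  by (simp add: below_def)

lemma plus_below_mono:
  assumes "x \<preceq> y" "x \<in> carrier A" "y \<in> carrier A" "z \<in> carrier A"
  shows "x \<oplus> z \<preceq> y \<oplus> z"
proof -
  obtain w where "w \<in> carrier A" "y = x \<oplus> w" using assms below_iff_plus by metis
  then have "y \<oplus> z = x \<oplus> z \<oplus> w" using assms by (simp add: plus_ac)
  then show ?thesis using assms \<open>w \<in> carrier A\<close> below_iff_plus by blast
qed

lemma neg_below_neg: "x \<in> carrier A \<Longrightarrow> y \<in> carrier A \<Longrightarrow> \<sim> y \<preceq> \<sim> x \<longleftrightarrow> x \<preceq> y"
  by (simp add: below_def plus_commute)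

text \<open>By associativity both sides unfold to the same equation. Thus the truncated difference
  \<open>\<sim> (\<sim> y \<oplus> x)\<close> is the least \<open>z\<close> with
  \<open>y \<preceq> x \<oplus> z\<close>, which is how relative complements are characterised
  later.\<close>

lemma residuation:
  "x \<in> carrier A \<Longrightarrow> y \<in> carrier A \<Longrightarrow> z \<in> carrier A \<Longrightarrow> \<sim> (\<sim> y \<oplus> x) \<preceq> z \<longleftrightarrow> y \<preceq> x \<oplus> z"
  by (simp add: below_def plus_assoc)

section \<open>Join and meet of the natural order\<close>

lemma sup_closed [simp, intro]:
  "x \<in> carrier A \<Longrightarrow> y \<in> carrier A \<Longrightarrow> mv_sup A x y \<in> carrier A"
  by (simp add: mv_sup_def)

lemma sup_commute: "x \<in> carrier A \<Longrightarrow> y \<in> carrier A \<Longrightarrow> mv_sup A x y = mv_sup A y x"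
  by (simp add: mv_sup_def lukasiewicz)

lemma sup_upper2: "x \<in> carrier A \<Longrightarrow> y \<in> carrier A \<Longrightarrow> y \<preceq> mv_sup A x y"
  by (simp add: mv_sup_def plus_commute below_plus)

lemma sup_upper1: "x \<in> carrier A \<Longrightarrow> y \<in> carrier A \<Longrightarrow> x \<preceq> mv_sup A x y"
  by (metis sup_commute sup_upper2)

lemma sup_absorb1: "x \<preceq> y \<Longrightarrow> x \<in> carrier A \<Longrightarrow> y \<in> carrier A \<Longrightarrow> mv_sup A x y = y"
  by (simp add: mv_sup_def below_def)

lemma sup_mono1:
  assumes "x \<preceq> z" "x \<in> carrier A" "y \<in> carrier A" "z \<in> carrier A"
  shows "mv_sup A x y \<preceq> mv_sup A z y"
  using assms by (simp add: mv_sup_def plus_below_mono neg_below_neg)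

text \<open>Replacing \<open>x\<close> by the larger \<open>z\<close> gives the join of
  \<open>z\<close> and \<open>y\<close>, which is \<open>z\<close> because
  \<open>y \<preceq> z\<close>.\<close>

lemma sup_least:
  assumes "x \<preceq> z" "y \<preceq> z" "x \<in> carrier A" "y \<in> carrier A" "z \<in> carrier A"
  shows "mv_sup A x y \<preceq> z"
  by (metis assms sup_absorb1 sup_commute sup_mono1)

lemma inf_closed [simp, intro]:
  "x \<in> carrier A \<Longrightarrow> y \<in> carrier A \<Longrightarrow> mv_inf A x y \<in> carrier A"
  by (simp add: mv_inf_def)

lemma inf_commute: "x \<in> carrier A \<Longrightarrow> y \<in> carrier A \<Longrightarrow> mv_inf A x y = mv_inf A y x"
  by (simp add: mv_inf_def sup_commute)

lemma inf_lower1: "x \<in> carrier A \<Longrightarrow> y \<in> carrier A \<Longrightarrow> mv_inf A x y \<preceq> x"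
  using neg_below_neg[of "mv_inf A x y" x] sup_upper1[of "\<sim> x" "\<sim> y"]
  by (simp add: mv_inf_def)

lemma inf_lower2: "x \<in> carrier A \<Longrightarrow> y \<in> carrier A \<Longrightarrow> mv_inf A x y \<preceq> y"
  by (metis inf_commute inf_lower1)

lemma inf_greatest:
  assumes "z \<preceq> x" "z \<preceq> y" "x \<in> carrier A" "y \<in> carrier A" "z \<in> carrier A"
  shows "z \<preceq> mv_inf A x y"
proof -
  have "mv_sup A (\<sim> x) (\<sim> y) \<preceq> \<sim> z" using assms by (simp add: sup_least neg_below_neg)
  then show ?thesis
    using assms neg_below_neg[of "mv_sup A (\<sim> x) (\<sim> y)" "\<sim> z"] by (simp add: mv_inf_def)
qed

lemma inf_one: "x \<in> carrier A \<Longrightarrow> mv_inf A x \<one> = x"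
  by (meson below_antisym below_one below_refl inf_closed inf_greatest inf_lower1 one_closed)

section \<open>Complements relative to an element of an MV-algebra\<close>

lemma neg_plus_residual:
  assumes "y \<preceq> b" "y \<in> carrier A" "b \<in> carrier A"
  shows "\<sim> b \<oplus> \<sim> (\<sim> b \<oplus> y) = \<sim> y"
proof -
  \<comment> \<open>Up to commutativity the left side of the goal is this join, and
    \<open>\<sim> b \<preceq> \<sim> y\<close>.\<close>
  have "mv_sup A (\<sim> y) (\<sim> b) = \<sim> y"
    using assms by (metis neg_below_neg neg_closed sup_absorb1 sup_commute)
  then show ?thesis using assms by (simp add: mv_sup_def plus_commute)
qed

lemma neg_plus_neg_idem:
  assumes "b \<oplus> b = b" "x \<preceq> b" "x \<in> carrier A" "b \<in> carrier A"
  shows "\<sim> x \<oplus> \<sim> b = \<sim> x"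
proof (rule below_antisym)
  \<comment> \<open>Idempotency makes \<open>b\<close> complemented: the join unfolds to
    \<open>\<sim> (b \<oplus> b) \<oplus> b\<close>. Enlarging \<open>\<sim> b\<close> to
    \<open>\<sim> x\<close> keeps the join at the top.\<close>
  have "mv_sup A (\<sim> b) b = \<one>" using assms by (simp add: mv_sup_def)
  moreover have "mv_sup A (\<sim> b) b \<preceq> mv_sup A (\<sim> x) b"
    using assms by (simp add: sup_mono1 neg_below_neg)
  ultimately have "mv_sup A b (\<sim> x) = \<one>"
    using assms by (metis below_antisym below_one neg_closed one_closed sup_closed sup_commute)
  \<comment> \<open>Unfolding \<open>mv_sup\<close> and \<open>below\<close> turns the previous
    equation into exactly this inequality.\<close>
  then show "\<sim> x \<oplus> \<sim> b \<preceq> \<sim> x"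
    using assms by (simp add: mv_sup_def below_def plus_commute)
qed (use assms in \<open>auto simp: below_plus\<close>)

text \<open>The residual \<open>\<sim> (\<sim> b \<oplus> y)\<close> is the complement of
  \<open>y\<close> relative to \<open>b\<close>. The summand \<open>\<sim> b\<close> restores it to
  \<open>\<sim> y\<close>, so that \<open>b\<close> disappears; \<open>residual_neg_both\<close>
  does the same for two complements.\<close>

lemma residual_neg_right:
  assumes "y \<preceq> b" "x \<in> carrier A" "y \<in> carrier A" "b \<in> carrier A"
  shows "\<sim> b \<oplus> (x \<oplus> \<sim> (\<sim> b \<oplus> y)) = x \<oplus> \<sim> y"
  using assms neg_plus_residual[of y b] by (metis neg_closed plus_closed plus_left_commute)

lemma residual_neg_both:
  assumes "b \<oplus> b = b" "x \<preceq> b" "y \<preceq> b" "x \<in> carrier A" "y \<in> carrier A" "b \<in> carrier A"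
  shows "\<sim> b \<oplus> (\<sim> (\<sim> b \<oplus> x) \<oplus> \<sim> (\<sim> b \<oplus> y)) = \<sim> x \<oplus> \<sim> y"
proof -
  have "\<sim> b \<oplus> (\<sim> (\<sim> b \<oplus> x) \<oplus> \<sim> (\<sim> b \<oplus> y)) = \<sim> x \<oplus> \<sim> (\<sim> b \<oplus> y)"
    using assms by (simp add: plus_assoc[symmetric] neg_plus_residual)
  \<comment> \<open>The single \<open>\<sim> b\<close> has been spent on the first residual. Since
    \<open>b\<close> is idempotent, \<open>\<sim> x\<close> equals
    \<open>\<sim> x \<oplus> \<sim> b\<close> and supplies another copy for the second.\<close>
  also have "\<dots> = \<sim> x \<oplus> (\<sim> b \<oplus> \<sim> (\<sim> b \<oplus> y))"
    using assms neg_plus_neg_idem[of b x] by (simp add: plus_assoc[symmetric])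
  finally show ?thesis using assms by (simp add: neg_plus_residual)
qed

end

section \<open>Intervals of an EMV-algebra\<close>

context emv_algebra
begin

abbreviation eplus_syn (infixl "\<oplus>" 65) where "x \<oplus> y \<equiv> emv_plus M x y"
abbreviation ezero_syn ("\<zero>") where "\<zero> \<equiv> emv_zero M"
abbreviation le_syn (infix "\<preceq>" 50) where "x \<preceq> y \<equiv> emv_le M x y"
abbreviation idem_syn ("E") where "E \<equiv> emv_idempotents M"
abbreviation lam where "lam \<equiv> emv_lam M \<zero>"
abbreviation interval where "interval b \<equiv> interval_mv M \<zero> b"

lemma le_iff: "x \<preceq> y \<longleftrightarrow> emv_inf M x y = x"
  by (simp add: emv_order_def)

lemma zero_closed [simp, intro]: "\<zero> \<in> carrier M"
  using zero_least by (simp add: least_def emv_order_def)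

lemma zero_le [simp]: "x \<in> carrier M \<Longrightarrow> \<zero> \<preceq> x"
  using zero_least by (simp add: least_def)

lemma plus_closed [simp, intro]: "x \<in> carrier M \<Longrightarrow> y \<in> carrier M \<Longrightarrow> x \<oplus> y \<in> carrier M"
  using comm_monoid.axioms(1)[OF plus_monoid, THEN monoid.m_closed] by simp

lemma plus_commute: "x \<in> carrier M \<Longrightarrow> y \<in> carrier M \<Longrightarrow> x \<oplus> y = y \<oplus> x"
  using comm_monoid.m_comm[OF plus_monoid] by simp

lemma plus_zero [simp]: "x \<in> carrier M \<Longrightarrow> x \<oplus> \<zero> = x"
  using comm_monoid.axioms(1)[OF plus_monoid, THEN monoid.r_one] by simp

lemma zero_plus [simp]: "x \<in> carrier M \<Longrightarrow> \<zero> \<oplus> x = x"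
  using comm_monoid.axioms(1)[OF plus_monoid, THEN monoid.l_one] by simp

lemma le_refl [simp]: "x \<in> carrier M \<Longrightarrow> x \<preceq> x"
  by (metis inf_absorb inf_closed le_iff sup_absorb)

lemma le_antisym: "x \<preceq> y \<Longrightarrow> y \<preceq> x \<Longrightarrow> x \<in> carrier M \<Longrightarrow> y \<in> carrier M \<Longrightarrow> x = y"
  by (metis inf_commute le_iff)

lemma le_trans:
  "x \<preceq> y \<Longrightarrow> y \<preceq> z \<Longrightarrow> x \<in> carrier M \<Longrightarrow> y \<in> carrier M \<Longrightarrow> z \<in> carrier M \<Longrightarrow> x \<preceq> z"
  by (metis inf_assoc le_iff)

lemma sup_upper1: "x \<in> carrier M \<Longrightarrow> y \<in> carrier M \<Longrightarrow> x \<preceq> emv_sup M x y"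
  by (simp add: le_iff inf_absorb)

lemma sup_upper2: "x \<in> carrier M \<Longrightarrow> y \<in> carrier M \<Longrightarrow> y \<preceq> emv_sup M x y"
  by (metis sup_upper1 sup_commute)

lemma sup_least:
  assumes "x \<preceq> z" "y \<preceq> z" "x \<in> carrier M" "y \<in> carrier M" "z \<in> carrier M"
  shows "emv_sup M x y \<preceq> z"
  by (metis assms distrib inf_commute le_iff sup_closed)

lemma inf_lower1: "x \<in> carrier M \<Longrightarrow> y \<in> carrier M \<Longrightarrow> emv_inf M x y \<preceq> x"
  by (metis inf_assoc inf_commute inf_closed le_iff le_refl)

lemma inf_lower2: "x \<in> carrier M \<Longrightarrow> y \<in> carrier M \<Longrightarrow> emv_inf M x y \<preceq> y"
  by (metis inf_lower1 inf_commute)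

lemma inf_greatest:
  "z \<preceq> x \<Longrightarrow> z \<preceq> y \<Longrightarrow> x \<in> carrier M \<Longrightarrow> y \<in> carrier M \<Longrightarrow> z \<in> carrier M \<Longrightarrow> z \<preceq> emv_inf M x y"
  by (metis inf_assoc le_iff)

lemma le_plus1: "x \<in> carrier M \<Longrightarrow> y \<in> carrier M \<Longrightarrow> x \<preceq> x \<oplus> y"
  using plus_mono[of \<zero> y x] by (simp add: plus_commute)

lemma le_plus2: "x \<in> carrier M \<Longrightarrow> y \<in> carrier M \<Longrightarrow> y \<preceq> x \<oplus> y"
  by (metis le_plus1 plus_commute)

lemma idem_iff: "b \<in> E \<longleftrightarrow> b \<in> carrier M \<and> b \<oplus> b = b"
  by (simp add: emv_idempotents_def)

lemma idem_closed [simp, intro]: "b \<in> E \<Longrightarrow> b \<in> carrier M"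
  by (simp only: idem_iff)

lemma idem_plus [simp]: "b \<in> E \<Longrightarrow> b \<oplus> b = b"
  by (simp only: idem_iff)

lemma zero_idem [simp]: "\<zero> \<in> E"
  unfolding idem_iff by simp

text \<open>An idempotent above \<open>x \<oplus> y\<close> lies above both summands. Hence the
  idempotents are directed, and any two evaluations can be compared in a common interval.\<close>

lemma idem_above:
  assumes "x \<in> carrier M" "y \<in> carrier M"
  obtains b where "b \<in> E" "x \<preceq> b" "y \<preceq> b"
proof -
  obtain b where "b \<in> E" "x \<oplus> y \<preceq> b" using below_idempotent assms by blast
  moreover from this have "x \<preceq> b" "y \<preceq> b"
    using assms le_trans[OF le_plus1, of x y b] le_trans[OF le_plus2, of x y b] by auto
  ultimately show thesis using that by blast
qed

section \<open>Intervals below an idempotent as MV-algebras\<close>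

lemma interval_simps [simp]:
  "x \<in> carrier (interval b) \<longleftrightarrow> x \<in> carrier M \<and> \<zero> \<preceq> x \<and> x \<preceq> b"
  "mv_plus (interval b) = emv_plus M" "mv_neg (interval b) = lam b"
  "mv_zero (interval b) = \<zero>" "mv_one (interval b) = b"
  by (auto simp: interval_mv_def at_least_at_most_def emv_order_def)

lemma interval_mv: "b \<in> E \<Longrightarrow> mv_algebra (interval b)"
  by (simp add: interval_mv_algebra)

lemma lam_closed [simp, intro]: "b \<in> E \<Longrightarrow> x \<in> carrier M \<Longrightarrow> x \<preceq> b \<Longrightarrow> lam b x \<in> carrier M"
  using mv_algebra.neg_closed[OF interval_mv, of b x] by simp

lemma lam_le [simp]: "b \<in> E \<Longrightarrow> x \<in> carrier M \<Longrightarrow> x \<preceq> b \<Longrightarrow> lam b x \<preceq> b"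
  using mv_algebra.neg_closed[OF interval_mv, of b x] by simp

lemma lam_lam [simp]: "b \<in> E \<Longrightarrow> x \<in> carrier M \<Longrightarrow> x \<preceq> b \<Longrightarrow> lam b (lam b x) = x"
  using mv_algebra.neg_neg[OF interval_mv, of b x] by simp

lemma plus_lam: "b \<in> E \<Longrightarrow> x \<in> carrier M \<Longrightarrow> x \<preceq> b \<Longrightarrow> x \<oplus> lam b x = b"
  using mv_algebra.plus_neg_self[OF interval_mv, of b x] by simp

lemma plus_le: "b \<in> E \<Longrightarrow> x \<in> carrier M \<Longrightarrow> y \<in> carrier M \<Longrightarrow> x \<preceq> b \<Longrightarrow> y \<preceq> b \<Longrightarrow> x \<oplus> y \<preceq> b"
  using mv_algebra.plus_closed[OF interval_mv, of b x y] by simp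

text \<open>The MV-order yields \<open>y = x \<oplus> w\<close>, which lies above \<open>x\<close>.
  Conversely, adding \<open>lam b x\<close> to \<open>x \<preceq> y\<close> gives a sum that is at
  least \<open>b\<close>, hence equal to \<open>b\<close> as the interval is closed under
  \<open>\<oplus>\<close>.\<close>

lemma interval_below_iff:
  assumes "b \<in> E" "x \<in> carrier M" "y \<in> carrier M" "x \<preceq> b" "y \<preceq> b"
  shows "mv_algebra.below (interval b) x y \<longleftrightarrow> x \<preceq> y"
proof -
  interpret A: mv_algebra "interval b" using assms by (simp add: interval_mv)
  have x: "x \<in> carrier (interval b)" and y: "y \<in> carrier (interval b)" using assms by auto
  show ?thesis
  proof
    assume "A.below x y"
    then obtain w where "w \<in> carrier M" "y = x \<oplus> w"
      using A.below_iff_plus[OF x y] by auto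
    then show "x \<preceq> y" using assms le_plus1 by simp
  next
    assume "x \<preceq> y"
    then have "x \<oplus> lam b x \<preceq> y \<oplus> lam b x"
      using assms plus_mono by simp
    then have "b \<preceq> lam b x \<oplus> y" using assms by (simp add: plus_lam plus_commute)
    then have "lam b x \<oplus> y = b" using assms by (intro le_antisym) (auto intro: plus_le)
    then show "A.below x y" by (simp add: A.below_def)
  qed
qed

text \<open>Both are least upper bounds of \<open>x\<close> and \<open>y\<close> for the same order,
  and both lie in the interval. The meet is treated dually in \<open>interval_inf\<close>.\<close>

lemma interval_sup:
  assumes "b \<in> E" "x \<in> carrier M" "y \<in> carrier M" "x \<preceq> b" "y \<preceq> b"
  shows "mv_sup (interval b) x y = emv_sup M x y"
proof -
  interpret A: mv_algebra "interval b" using assms by (simp add: interval_mv)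
  have x: "x \<in> carrier (interval b)" and y: "y \<in> carrier (interval b)" using assms by auto
  note s = A.sup_closed[OF x y]
  have t: "emv_sup M x y \<in> carrier (interval b)"
    using assms by (simp add: sup_closed sup_least)
  have "A.below (mv_sup (interval b) x y) (emv_sup M x y)"
    using assms t x y by (intro A.sup_least) (auto simp: interval_below_iff sup_upper1 sup_upper2)
  then have "mv_sup (interval b) x y \<preceq> emv_sup M x y"
    using s t assms by (auto simp: interval_below_iff)
  moreover have "emv_sup M x y \<preceq> mv_sup (interval b) x y"
    using A.sup_upper1[OF x y] A.sup_upper2[OF x y] s assms
    by (intro sup_least) (auto simp: interval_below_iff)
  ultimately show ?thesis using s t by (intro le_antisym) auto
qed

lemma interval_inf:
  assumes "b \<in> E" "x \<in> carrier M" "y \<in> carrier M" "x \<preceq> b" "y \<preceq> b"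
  shows "mv_inf (interval b) x y = emv_inf M x y"
proof -
  interpret A: mv_algebra "interval b" using assms by (simp add: interval_mv)
  have x: "x \<in> carrier (interval b)" and y: "y \<in> carrier (interval b)" using assms by auto
  note s = A.inf_closed[OF x y]
  have t: "emv_inf M x y \<in> carrier (interval b)"
    using assms le_trans[OF inf_lower1, of x y b] by (simp add: inf_closed)
  have "A.below (emv_inf M x y) (mv_inf (interval b) x y)"
    using assms t x y by (intro A.inf_greatest) (auto simp: interval_below_iff inf_lower1 inf_lower2)
  then have "emv_inf M x y \<preceq> mv_inf (interval b) x y"
    using s t assms by (auto simp: interval_below_iff)
  moreover have "mv_inf (interval b) x y \<preceq> emv_inf M x y"
    using A.inf_lower1[OF x y] A.inf_lower2[OF x y] s assms
    by (intro inf_greatest) (auto simp: interval_below_iff)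
  ultimately show ?thesis using s t by (intro le_antisym) auto
qed

section \<open>Relative complements in nested intervals\<close>

lemma lam_le_iff:
  assumes "b \<in> E" "x \<in> carrier M" "y \<in> carrier M" "x \<preceq> b" "y \<preceq> b"
  shows "lam b x \<preceq> y \<longleftrightarrow> x \<oplus> y = b"
proof -
  interpret A: mv_algebra "interval b" using assms by (simp add: interval_mv)
  have "lam b x \<preceq> y \<longleftrightarrow> A.below (lam b x) y"
    using assms by (simp add: interval_below_iff)
  then show ?thesis using assms by (simp add: A.below_def)
qed

text \<open>The right side is the truncated difference of \<open>b\<close> and \<open>x\<close>
  computed in \<open>[0,c]\<close>. By residuation it is the least \<open>z\<close> with
  \<open>b \<preceq> x \<oplus> z\<close>, and below \<open>b\<close> this condition says
  \<open>x \<oplus> z = b\<close>.\<close>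

lemma lam_change_top:
  assumes "b \<in> E" "c \<in> E" "b \<preceq> c" "x \<in> carrier M" "x \<preceq> b"
  shows "lam b x = lam c (lam c b \<oplus> x)"
proof -
  interpret A: mv_algebra "interval c" using assms by (simp add: interval_mv)
  define d where "d = lam c (lam c b \<oplus> x)"
  have xc: "x \<preceq> c" using assms le_trans by blast
  then have d: "d \<in> carrier M" "d \<preceq> c"
    using assms unfolding d_def by (auto intro: lam_closed lam_le plus_le)
  have res: "d \<preceq> z \<longleftrightarrow> b \<preceq> x \<oplus> z" if "z \<in> carrier M" "z \<preceq> c" for z
    using A.residuation[of x b z] assms that xc d
    by (simp add: interval_below_iff plus_le flip: d_def)
  \<comment> \<open>The choice \<open>z = b\<close> in \<open>res\<close> brings \<open>d\<close>
    into the smaller interval, where \<open>x \<oplus> d\<close> cannot exceed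
    \<open>b\<close>.\<close>
  have db: "d \<preceq> b" using res[of b] assms by (simp add: le_plus2)
  then have "x \<oplus> d \<preceq> b" using assms d by (simp add: plus_le)
  moreover have "b \<preceq> x \<oplus> d" using res[of d] d by simp
  ultimately have "x \<oplus> d = b" using assms d by (intro le_antisym) auto
  then have "lam b x \<preceq> d" using assms d db by (simp add: lam_le_iff)
  moreover have "lam b x \<preceq> c" using assms le_trans[OF lam_le, of b x c] by simp
  then have "d \<preceq> lam b x" using res[of "lam b x"] assms by (simp add: plus_lam)
  ultimately show ?thesis unfolding d_def[symmetric] using assms d by (intro le_antisym) auto
qed

text \<open>Moving every complement from \<open>[0,b]\<close> to \<open>[0,c]\<close> by
  \<open>lam_change_top\<close> introduces \<open>lam c b\<close>, which the residual identities for
  MV-algebras remove again. This is why sums involving a formal complement can be defined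
  independently of \<open>b\<close>.\<close>

lemma lam_plus_lam_change_top:
  assumes "b \<in> E" "c \<in> E" "b \<preceq> c" "x \<in> carrier M" "y \<in> carrier M" "x \<preceq> b" "y \<preceq> b"
  shows "lam b (x \<oplus> lam b y) = lam c (x \<oplus> lam c y)"
    and "lam b (lam b x \<oplus> lam b y) = lam c (lam c x \<oplus> lam c y)"
proof -
  interpret A: mv_algebra "interval c" using assms by (simp add: interval_mv)
  have c: "x \<preceq> c" "y \<preceq> c" using assms le_trans by blast+
  have y: "lam b y = lam c (lam c b \<oplus> y)" and x: "lam b x = lam c (lam c b \<oplus> x)"
    using assms by (auto intro: lam_change_top)
  have "lam b (x \<oplus> lam b y) = lam c (lam c b \<oplus> (x \<oplus> lam b y))"
    using assms by (intro lam_change_top) (auto intro: plus_le)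
  also have "\<dots> = lam c (x \<oplus> lam c y)"
    using A.residual_neg_right[of y b x] assms c by (simp add: y interval_below_iff)
  finally show "lam b (x \<oplus> lam b y) = lam c (x \<oplus> lam c y)" .
  have "lam b (lam b x \<oplus> lam b y) = lam c (lam c b \<oplus> (lam b x \<oplus> lam b y))"
    using assms by (intro lam_change_top) (auto intro: plus_le)
  also have "\<dots> = lam c (lam c x \<oplus> lam c y)"
    using A.residual_neg_both[of b x y] assms c by (simp add: x y interval_below_iff)
  finally show "lam b (lam b x \<oplus> lam b y) = lam c (lam c x \<oplus> lam c y)" .
qed

text \<open>A top \<open>t\<close> is idempotent because \<open>t \<oplus> t\<close> lies between
  \<open>t\<close> and the top, so the MV-algebra \<open>[0,t]\<close> is all of
  \<open>M\<close>.\<close>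

lemma is_mv_if_greatest:
  assumes "greatest (emv_order M) t (carrier M)"
  shows "emv_is_mv M"
proof -
  have t: "t \<in> carrier M" "\<And>x. x \<in> carrier M \<Longrightarrow> x \<preceq> t"
    using assms by (auto simp: greatest_def)
  then have "t \<oplus> t = t" by (intro le_antisym) (auto intro: le_plus1)
  then have "t \<in> E" using t idem_iff by blast
  then have "mv_algebra (interval t)" by (rule interval_mv)
  moreover have "interval t = \<lparr>carrier = carrier M, mv_plus = emv_plus M,
        mv_neg = lam t, mv_zero = \<zero>, mv_one = t\<rparr>"
  proof -
    have "carrier (interval t) = carrier M" using t by auto
    then show ?thesis by (simp add: interval_mv_def)
  qed
  ultimately show ?thesis using assms unfolding emv_is_mv_def by auto
qed

end

section \<open>Adjoining formal complements\<close>

context emv_algebra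
begin

text \<open>An idempotent \<open>b\<close> is admissible for evaluating \<open>u\<close> when it
  lies above \<open>base u\<close>.\<close>

fun base :: "'a + 'a \<Rightarrow> 'a" where
  "base (Inl x) = x"
| "base (Inr x) = x"

fun ev :: "'a \<Rightarrow> 'a + 'a \<Rightarrow> 'a" where
  "ev b (Inl x) = x"
| "ev b (Inr x) = lam b x"

definition ext_carrier :: "('a + 'a) set" where
  "ext_carrier = carrier M <+> carrier M"

text \<open>An arbitrary choice, made only to write down a sum; \<open>lam_ev_unique\<close> shows
  that it does not affect the result.\<close>

definition idem_bound :: "'a \<Rightarrow> 'a \<Rightarrow> 'a" where
  "idem_bound x y = (SOME b. b \<in> E \<and> x \<preceq> b \<and> y \<preceq> b)"

text \<open>The second equation covers the three cases with a formal complement. The sum is then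
  again a formal complement, and its base is recovered by complementing the evaluated sum in
  \<open>[0,b]\<close>.\<close>

fun ext_plus :: "'a + 'a \<Rightarrow> 'a + 'a \<Rightarrow> 'a + 'a" where
  "ext_plus (Inl x) (Inl y) = Inl (x \<oplus> y)"
| "ext_plus u v = Inr (let b = idem_bound (base u) (base v) in lam b (ev b u \<oplus> ev b v))"

fun ext_neg :: "'a + 'a \<Rightarrow> 'a + 'a" where
  "ext_neg (Inl x) = Inr x"
| "ext_neg (Inr x) = Inl x"

definition ext :: "('a + 'a) mv" where
  "ext = \<lparr>carrier = ext_carrier, mv_plus = ext_plus, mv_neg = ext_neg,
    mv_zero = Inl \<zero>, mv_one = Inr \<zero>\<rparr>"

lemma ext_simps [simp]:
  "carrier ext = ext_carrier" "mv_plus ext = ext_plus" "mv_neg ext = ext_neg"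
  "mv_zero ext = Inl \<zero>" "mv_one ext = Inr \<zero>"
  by (simp_all add: ext_def)

lemma Inl_ext [simp]: "Inl x \<in> ext_carrier \<longleftrightarrow> x \<in> carrier M"
  and Inr_ext [simp]: "Inr x \<in> ext_carrier \<longleftrightarrow> x \<in> carrier M"
  by (auto simp: ext_carrier_def)

lemma base_closed [simp, intro]: "u \<in> ext_carrier \<Longrightarrow> base u \<in> carrier M"
  by (cases u) auto

lemma ev_closed [simp, intro]: "b \<in> E \<Longrightarrow> u \<in> ext_carrier \<Longrightarrow> base u \<preceq> b \<Longrightarrow> ev b u \<in> carrier M"
  by (cases u) auto

lemma ev_le [simp]: "b \<in> E \<Longrightarrow> u \<in> ext_carrier \<Longrightarrow> base u \<preceq> b \<Longrightarrow> ev b u \<preceq> b"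
  by (cases u) auto

lemma idem_bound:
  assumes "x \<in> carrier M" "y \<in> carrier M"
  shows "idem_bound x y \<in> E" "x \<preceq> idem_bound x y" "y \<preceq> idem_bound x y"
proof -
  have "\<exists>b. b \<in> E \<and> x \<preceq> b \<and> y \<preceq> b" using idem_above assms by metis
  from someI_ex[OF this] show "idem_bound x y \<in> E" "x \<preceq> idem_bound x y" "y \<preceq> idem_bound x y"
    unfolding idem_bound_def by auto
qed

section \<open>Independence of sums from the chosen idempotent\<close>

lemma lam_ev_change_top:
  assumes "b \<in> E" "c \<in> E" "b \<preceq> c" "u \<in> ext_carrier" "v \<in> ext_carrier" "base u \<preceq> b" "base v \<preceq> b"
    and "\<not> (isl u \<and> isl v)"
  shows "lam b (ev b u \<oplus> ev b v) = lam c (ev c u \<oplus> ev c v)"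
proof -
  have le: "x \<preceq> c" if "x \<in> carrier M" "x \<preceq> b" for x
    using le_trans[OF that(2) assms(3)] that assms by simp
  show ?thesis
  proof (cases u; cases v)
    fix x y assume "u = Inl x" "v = Inr y"
    then show ?thesis using assms lam_plus_lam_change_top(1)[of b c x y] by simp
  next
    fix x y assume "u = Inr x" "v = Inl y"
    then show ?thesis using assms le lam_plus_lam_change_top(1)[of b c y x]
        plus_commute[of "lam b x" y] plus_commute[of "lam c x" y] by simp
  next
    fix x y assume "u = Inr x" "v = Inr y"
    then show ?thesis using assms lam_plus_lam_change_top(2)[of b c x y] by simp
  qed (use assms in simp)
qed

text \<open>Both sides agree with the value at a common idempotent \<open>d\<close> above
  \<open>b\<close> and \<open>c\<close>.\<close>

lemma lam_ev_unique:
  assumes "b \<in> E" "c \<in> E" "u \<in> ext_carrier" "v \<in> ext_carrier"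
    and "base u \<preceq> b" "base v \<preceq> b" "base u \<preceq> c" "base v \<preceq> c" "\<not> (isl u \<and> isl v)"
  shows "lam b (ev b u \<oplus> ev b v) = lam c (ev c u \<oplus> ev c v)"
proof -
  obtain d where "d \<in> E" "b \<preceq> d" "c \<preceq> d" using idem_above assms idem_closed by metis
  then show ?thesis using assms lam_ev_change_top by metis
qed

lemma ext_plus_not_isl:
  assumes "b \<in> E" "u \<in> ext_carrier" "v \<in> ext_carrier" "base u \<preceq> b" "base v \<preceq> b" "\<not> (isl u \<and> isl v)"
  shows "ext_plus u v = Inr (lam b (ev b u \<oplus> ev b v))"
proof -
  define c where "c = idem_bound (base u) (base v)"
  have c: "c \<in> E" "base u \<preceq> c" "base v \<preceq> c" using idem_bound assms by (auto simp: c_def)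
  have "ext_plus u v = Inr (lam c (ev c u \<oplus> ev c v))"
    using assms(6) by (cases u; cases v) (simp_all add: c_def Let_def)
  then show ?thesis using lam_ev_unique[of b c u v] assms c by simp
qed

text \<open>For a formal complement the sum evaluates to a double complement in
  \<open>[0,b]\<close>, which cancels. Together with \<open>ext_neg_ev\<close> this makes evaluation
  at \<open>b\<close> compatible with all MV-terms in elements whose bases lie below
  \<open>b\<close>.\<close>

lemma ext_plus_ev:
  assumes "b \<in> E" "u \<in> ext_carrier" "v \<in> ext_carrier" "base u \<preceq> b" "base v \<preceq> b"
  shows "ext_plus u v \<in> ext_carrier" "base (ext_plus u v) \<preceq> b"
    "ev b (ext_plus u v) = ev b u \<oplus> ev b v"
proof -
  have "ext_plus u v \<in> ext_carrier \<and> base (ext_plus u v) \<preceq> b \<and>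
    ev b (ext_plus u v) = ev b u \<oplus> ev b v"
  proof (cases "\<not> (isl u \<and> isl v)")
    case True
    have "ev b u \<oplus> ev b v \<preceq> b" using assms by (simp add: plus_le)
    then show ?thesis using assms ext_plus_not_isl[OF assms True] by simp
  next
    case False
    then show ?thesis using assms by (cases u; cases v) (auto simp: plus_le)
  qed
  then show "ext_plus u v \<in> ext_carrier" "base (ext_plus u v) \<preceq> b"
    "ev b (ext_plus u v) = ev b u \<oplus> ev b v" by auto
qed

lemma ext_neg_ev:
  assumes "b \<in> E" "u \<in> ext_carrier" "base u \<preceq> b"
  shows "ext_neg u \<in> ext_carrier" "base (ext_neg u) \<preceq> b" "ev b (ext_neg u) = lam b (ev b u)"
  using assms by (cases u; simp)+

lemma lam_zero: "b \<in> E \<Longrightarrow> lam b \<zero> = b"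
  using plus_lam[of b \<zero>] by simp

text \<open>As \<open>mv_sup\<close> is a term in sum and complement, evaluation carries it to
  \<open>mv_sup\<close> of \<open>[0,b]\<close>, which is the join of \<open>M\<close>.\<close>

lemma ext_sup_ev:
  assumes "b \<in> E" "u \<in> ext_carrier" "v \<in> ext_carrier" "base u \<preceq> b" "base v \<preceq> b"
  shows "mv_sup ext u v \<in> ext_carrier" "base (mv_sup ext u v) \<preceq> b"
    "ev b (mv_sup ext u v) = emv_sup M (ev b u) (ev b v)"
proof -
  show "mv_sup ext u v \<in> ext_carrier" "base (mv_sup ext u v) \<preceq> b"
    using assms by (simp_all add: mv_sup_def ext_neg_ev ext_plus_ev)
  have "ev b (mv_sup ext u v) = mv_sup (interval b) (ev b u) (ev b v)"
    using assms by (simp add: mv_sup_def ext_neg_ev ext_plus_ev)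
  then show "ev b (mv_sup ext u v) = emv_sup M (ev b u) (ev b v)"
    using assms by (simp add: interval_sup)
qed

lemma ext_inf_ev:
  assumes "b \<in> E" "u \<in> ext_carrier" "v \<in> ext_carrier" "base u \<preceq> b" "base v \<preceq> b"
  shows "mv_inf ext u v \<in> ext_carrier" "base (mv_inf ext u v) \<preceq> b"
    "ev b (mv_inf ext u v) = emv_inf M (ev b u) (ev b v)"
proof -
  show "mv_inf ext u v \<in> ext_carrier" "base (mv_inf ext u v) \<preceq> b"
    using assms by (simp_all add: mv_inf_def ext_neg_ev ext_sup_ev)
  have "ev b (mv_inf ext u v) = mv_inf (interval b) (ev b u) (ev b v)"
    using assms by (simp add: mv_inf_def mv_sup_def ext_neg_ev ext_plus_ev)
  then show "ev b (mv_inf ext u v) = emv_inf M (ev b u) (ev b v)"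
    using assms by (simp add: interval_inf)
qed

end

section \<open>Algebras without a top: separation of elements by evaluations\<close>

locale topless_emv_algebra = emv_algebra +
  assumes no_top: "t \<in> carrier M \<Longrightarrow> \<exists>x \<in> carrier M. \<not> emv_le M x t"
begin

text \<open>The absence of a top enters here: some \<open>x\<close> is not below \<open>b\<close>,
  and an idempotent above both \<open>b\<close> and \<open>x\<close> differs from
  \<open>b\<close>.\<close>

lemma idem_not_eventually_constant:
  assumes "b \<in> E" "\<And>c. c \<in> E \<Longrightarrow> b \<preceq> c \<Longrightarrow> c = t"
  shows False
proof -
  obtain x where x: "x \<in> carrier M" "\<not> x \<preceq> b" using no_top assms by blast
  obtain c where "c \<in> E" "b \<preceq> c" "x \<preceq> c" using idem_above x assms idem_closed by metis
  then show False using assms x by (metis idem_closed le_refl)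
qed

text \<open>The inequality says \<open>y \<oplus> x = c\<close>, so all idempotents above
  \<open>b\<close> would coincide. Assuming only an inequality serves both the separation of
  \<open>Inl\<close> from \<open>Inr\<close> and the order comparison in
  \<open>not_ext_le_Inr_Inl\<close>.\<close>

lemma ev_Inl_neq_Inr:
  assumes "b \<in> E" "x \<in> carrier M" "y \<in> carrier M" "x \<preceq> b" "y \<preceq> b"
    and "\<And>c. c \<in> E \<Longrightarrow> b \<preceq> c \<Longrightarrow> lam c y \<preceq> x"
  shows False
proof (rule idem_not_eventually_constant[OF assms(1)])
  fix c assume c: "c \<in> E" "b \<preceq> c"
  then have "x \<preceq> c" "y \<preceq> c" using assms le_trans idem_closed by metis+
  then show "c = y \<oplus> x" using assms(6)[OF c] c assms by (simp add: lam_le_iff)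
qed

text \<open>Two elements of the same kind are already separated at \<open>b\<close>. An
  \<open>Inl\<close> and an \<open>Inr\<close> may agree at one idempotent, but not at all those
  above \<open>b\<close>.\<close>

lemma ext_eqI:
  assumes "b \<in> E" "u \<in> ext_carrier" "v \<in> ext_carrier" "base u \<preceq> b" "base v \<preceq> b"
    and eq: "\<And>c. c \<in> E \<Longrightarrow> base u \<preceq> c \<Longrightarrow> base v \<preceq> c \<Longrightarrow> b \<preceq> c \<Longrightarrow> ev c u = ev c v"
  shows "u = v"
proof -
  note uvb = assms(1-5)
  have above: "z \<preceq> c" if "z \<preceq> b" "b \<preceq> c" "c \<in> E" "z \<in> carrier M" for z c
    using that assms(1) le_trans idem_closed by metis
  show ?thesis
  proof (cases u; cases v)
    fix x y assume uv: "u = Inl x" "v = Inl y"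
    show ?thesis using eq[of b] uvb uv by simp
  next
    fix x y assume uv: "u = Inr x" "v = Inr y"
    then have "lam b x = lam b y" using eq[of b] uvb by simp
    then show ?thesis using uvb uv by (metis Inr_ext base.simps(2) lam_lam)
  next
    fix x y assume uv: "u = Inl x" "v = Inr y"
    have "lam c y \<preceq> x" if "c \<in> E" "b \<preceq> c" for c
    proof -
      have "x = lam c y" using eq[of c] that uv uvb above[of _ c] by auto
      then show ?thesis using uvb uv by (metis Inl_ext le_refl)
    qed
    then show ?thesis using ev_Inl_neq_Inr[of b x y] uvb uv by simp
  next
    fix x y assume uv: "u = Inr x" "v = Inl y"
    have "lam c x \<preceq> y" if "c \<in> E" "b \<preceq> c" for c
    proof -
      have "lam c x = y" using eq[of c] that uv uvb above[of _ c] by auto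
      then show ?thesis using uvb uv by simp
    qed
    then show ?thesis using ev_Inl_neq_Inr[of b y x] uvb uv by simp
  qed
qed

text \<open>The bound is stated for every \<open>c\<close> above \<open>b\<close> because
  \<open>ext_eqI\<close> compares evaluations at all such \<open>c\<close>.\<close>

lemma idem_above3:
  assumes "x \<in> carrier M" "y \<in> carrier M" "z \<in> carrier M"
  obtains b where "b \<in> E" "\<And>c. c \<in> E \<Longrightarrow> b \<preceq> c \<Longrightarrow> x \<preceq> c \<and> y \<preceq> c \<and> z \<preceq> c"
proof -
  obtain a where a: "a \<in> E" "x \<preceq> a" "y \<preceq> a" using idem_above assms by metis
  obtain b where b: "b \<in> E" "a \<preceq> b" "z \<preceq> b" using idem_above[of a z] a assms by auto
  then have "x \<preceq> c \<and> y \<preceq> c \<and> z \<preceq> c" if "c \<in> E" "b \<preceq> c" for c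
    using a b assms that by (meson idem_closed le_trans)
  then show thesis using b that by blast
qed

text \<open>Each equation holds after evaluation in every sufficiently large \<open>[0,c]\<close>,
  and \<open>ext_eqI\<close> lifts it to \<open>ext\<close>.\<close>

lemma ext_mv: "mv_algebra ext"
proof (rule mv_algebra.intro)
  have cl: "ext_plus u v \<in> ext_carrier" if "u \<in> ext_carrier" "v \<in> ext_carrier" for u v
    using that idem_above[of "base u" "base v"] ext_plus_ev by blast
  have comm: "ext_plus u v = ext_plus v u" if uv: "u \<in> ext_carrier" "v \<in> ext_carrier" for u v
  proof -
    obtain b where b: "b \<in> E" "base u \<preceq> b" "base v \<preceq> b"
      using idem_above[of "base u" "base v"] uv by auto
    show ?thesis
    proof (rule ext_eqI[OF b(1)])
      fix c assume c: "c \<in> E" "b \<preceq> c"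
      then have "base u \<preceq> c" "base v \<preceq> c" using b uv le_trans[of _ b c] by auto
      then show "ev c (ext_plus u v) = ev c (ext_plus v u)"
        using c uv by (simp add: ext_plus_ev plus_commute)
    qed (use b uv in \<open>auto intro: ext_plus_ev\<close>)
  qed
  have assoc: "ext_plus (ext_plus u v) w = ext_plus u (ext_plus v w)"
    if uvw: "u \<in> ext_carrier" "v \<in> ext_carrier" "w \<in> ext_carrier" for u v w
  proof -
    obtain b where b: "b \<in> E"
      "\<And>c. c \<in> E \<Longrightarrow> b \<preceq> c \<Longrightarrow> base u \<preceq> c \<and> base v \<preceq> c \<and> base w \<preceq> c"
      using idem_above3[of "base u" "base v" "base w"] uvw by auto
    have b': "base u \<preceq> b" "base v \<preceq> b" "base w \<preceq> b" using b(2)[of b] b(1) by auto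
    show ?thesis
    proof (rule ext_eqI[OF b(1)])
      fix c assume c: "c \<in> E" "b \<preceq> c"
      interpret A: mv_algebra "interval c" using c interval_mv by simp
      show "ev c (ext_plus (ext_plus u v) w) = ev c (ext_plus u (ext_plus v w))"
        using A.plus_assoc[of "ev c u" "ev c v" "ev c w"] c b(2)[OF c] uvw
        by (simp add: ext_plus_ev)
    qed (use b b' uvw in \<open>auto intro!: ext_plus_ev\<close>)
  qed
  have zero: "ext_plus (Inl \<zero>) u = u" if u: "u \<in> ext_carrier" for u
  proof -
    obtain b where b: "b \<in> E" "base u \<preceq> b" using below_idempotent u by blast
    show ?thesis
    proof (rule ext_eqI[OF b(1)])
      fix c assume c: "c \<in> E" "base u \<preceq> c"
      then show "ev c (ext_plus (Inl \<zero>) u) = ev c u" using u by (simp add: ext_plus_ev)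
    qed (use b u in \<open>auto intro!: ext_plus_ev\<close>)
  qed
  show "comm_monoid \<lparr>carrier = carrier ext, monoid.mult = mv_plus ext, one = mv_zero ext\<rparr>"
    by (rule comm_monoidI) (simp_all add: cl assoc zero, simp add: comm)
  show "mv_neg ext u \<in> carrier ext" if "u \<in> carrier ext" for u
    using that by (cases u) auto
  show "mv_neg ext (mv_neg ext u) = u" for u by (cases u) auto
  show "mv_plus ext u (mv_one ext) = mv_one ext" if "u \<in> carrier ext" for u
  proof -
    have u: "u \<in> ext_carrier" using that by simp
    then obtain b where b: "b \<in> E" "base u \<preceq> b" using below_idempotent by blast
    have "ext_plus u (Inr \<zero>) = Inr \<zero>"
    proof (rule ext_eqI[OF b(1)])
      fix c assume c: "c \<in> E" "b \<preceq> c"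
      then have c': "base u \<preceq> c" using b u le_trans[of _ b c] by auto
      interpret A: mv_algebra "interval c" using c interval_mv by simp
      \<comment> \<open>By \<open>lam_zero\<close> the unit \<open>Inr \<zero>\<close> evaluates to
        \<open>c\<close>, the top of \<open>[0,c]\<close>. The sum is kept folded so that
        \<open>ext_plus_ev\<close> applies instead of the chosen bound appearing.\<close>
      show "ev c (ext_plus u (Inr \<zero>)) = ev c (Inr \<zero>)"
        using c c' u A.plus_one[of "ev c u"]
        by (simp add: ext_plus_ev lam_zero del: ext_plus.simps)
    qed (use b u in \<open>auto simp: ext_plus_ev simp del: ext_plus.simps\<close>)
    then show ?thesis by simp
  qed
  show "mv_plus ext (mv_neg ext (mv_plus ext (mv_neg ext u) v)) v =
      mv_plus ext (mv_neg ext (mv_plus ext (mv_neg ext v) u)) u"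
    if "u \<in> carrier ext" "v \<in> carrier ext" for u v
  proof -
    have uv: "u \<in> ext_carrier" "v \<in> ext_carrier" using that by auto
    obtain b where b: "b \<in> E" "base u \<preceq> b" "base v \<preceq> b"
      using idem_above[of "base u" "base v"] uv by auto
    \<comment> \<open>The Lukasiewicz axiom is commutativity of \<open>mv_sup\<close>, whose
      evaluations are joins in \<open>M\<close>.\<close>
    have "mv_sup ext u v = mv_sup ext v u"
    proof (rule ext_eqI[OF b(1)])
      fix c assume c: "c \<in> E" "b \<preceq> c"
      then have "base u \<preceq> c" "base v \<preceq> c" using b uv le_trans[of _ b c] by auto
      then show "ev c (mv_sup ext u v) = ev c (mv_sup ext v u)"
        using c uv by (simp add: ext_sup_ev sup_commute)
    qed (use b uv in \<open>auto intro: ext_sup_ev\<close>)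
    then show ?thesis by (simp add: mv_sup_def)
  qed
qed simp_all

section \<open>Lattice operations on the image of the embedding\<close>

lemma ext_sup_Inl:
  assumes "x \<in> carrier M" "y \<in> carrier M"
  shows "mv_sup ext (Inl x) (Inl y) = Inl (emv_sup M x y)"
proof -
  obtain b where b: "b \<in> E" "x \<preceq> b" "y \<preceq> b" using idem_above assms by metis
  \<comment> \<open>The term \<open>mv_sup\<close> passes through formal complements, so its result
    is recognised as an \<open>Inl\<close> by comparing evaluations.\<close>
  show ?thesis
  proof (rule ext_eqI[OF b(1)])
    fix c assume c: "c \<in> E" "b \<preceq> c"
    then have "x \<preceq> c" "y \<preceq> c" using b assms le_trans[of _ b c] by auto
    then show "ev c (mv_sup ext (Inl x) (Inl y)) = ev c (Inl (emv_sup M x y))"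
      using c assms by (simp add: ext_sup_ev)
  qed (use b assms in \<open>auto intro: ext_sup_ev sup_closed sup_least\<close>)
qed

lemma ext_inf_Inl:
  assumes "x \<in> carrier M" "y \<in> carrier M"
  shows "mv_inf ext (Inl x) (Inl y) = Inl (emv_inf M x y)"
proof -
  obtain b where b: "b \<in> E" "x \<preceq> b" "y \<preceq> b" using idem_above assms by metis
  show ?thesis
  proof (rule ext_eqI[OF b(1)])
    fix c assume c: "c \<in> E" "b \<preceq> c"
    then have "x \<preceq> c" "y \<preceq> c" using b assms le_trans[of _ b c] by auto
    then show "ev c (mv_inf ext (Inl x) (Inl y)) = ev c (Inl (emv_inf M x y))"
      using c assms by (simp add: ext_inf_ev)
  qed (use b assms in \<open>auto intro: ext_inf_ev inf_closed le_trans[OF inf_lower1]\<close>)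
qed

lemma emv_of_ext_simps [simp]:
  "carrier (emv_of_mv ext) = ext_carrier" "emv_sup (emv_of_mv ext) = mv_sup ext"
  "emv_inf (emv_of_mv ext) = mv_inf ext" "emv_plus (emv_of_mv ext) = ext_plus"
  "emv_zero (emv_of_mv ext) = Inl \<zero>"
  by (simp_all add: emv_of_mv_def)

section \<open>Order and relative complements in the enlarged algebra\<close>

abbreviation ext_le where "ext_le \<equiv> emv_le (emv_of_mv ext)"

lemma ext_le_iff: "ext_le u v \<longleftrightarrow> mv_inf ext u v = u"
  by (simp add: emv_order_def emv_of_mv_def)

lemma ext_le_Inl: "x \<in> carrier M \<Longrightarrow> y \<in> carrier M \<Longrightarrow> ext_le (Inl x) (Inl y) \<longleftrightarrow> x \<preceq> y"
  by (simp add: ext_le_iff ext_inf_Inl le_iff)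

text \<open>Evaluating such an inequality would give \<open>lam c x \<preceq> y\<close> for all
  large idempotents \<open>c\<close>, which \<open>ev_Inl_neq_Inr\<close> excludes.\<close>

lemma not_ext_le_Inr_Inl:
  assumes "x \<in> carrier M" "y \<in> carrier M"
  shows "\<not> ext_le (Inr x) (Inl y)"
proof
  assume "ext_le (Inr x) (Inl y)"
  then have le: "mv_inf ext (Inr x) (Inl y) = Inr x" by (simp add: ext_le_iff)
  obtain b where b: "b \<in> E" "y \<preceq> b" "x \<preceq> b" using idem_above assms by metis
  show False
  proof (rule ev_Inl_neq_Inr[OF b(1) assms(2,1) b(2,3)])
    fix c assume c: "c \<in> E" "b \<preceq> c"
    then have "x \<preceq> c" "y \<preceq> c" using b assms le_trans[of _ b c] by auto
    then show "lam c x \<preceq> y"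
      using ext_inf_ev(3)[of c "Inr x" "Inl y"] le c assms by (simp add: le_iff)
  qed
qed

lemma carrier_order: "carrier (emv_order X) = carrier X"
  by (simp add: emv_order_def)

text \<open>No formal complement lies below \<open>Inl b\<close>, so the set whose minimum is taken
  in \<open>ext\<close> is the image of the corresponding set in \<open>M\<close>.\<close>

lemma ext_lam_Inl:
  assumes "b \<in> E" "x \<in> carrier M" "x \<preceq> b"
  shows "emv_lam (emv_of_mv ext) (Inl \<zero>) (Inl b) (Inl x) = Inl (lam b x)"
proof -
  let ?S = "{z \<in> emv_interval (emv_of_mv ext) (Inl \<zero>) (Inl b).
    emv_plus (emv_of_mv ext) (Inl x) z = Inl b}"
  have "w \<in> ?S \<longleftrightarrow> (\<exists>z. w = Inl z \<and> z \<in> carrier M \<and> z \<preceq> b \<and> x \<oplus> z = b)" for w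
    using assms not_ext_le_Inr_Inl[of _ b]
    by (cases w) (auto simp: at_least_at_most_def ext_le_Inl carrier_order)
  then have S: "?S = Inl ` {z \<in> carrier M. z \<preceq> b \<and> x \<oplus> z = b}" by blast
  have least: "least (emv_order (emv_of_mv ext)) (Inl (lam b x)) ?S"
    unfolding S least_def using assms
    by (auto simp: carrier_order plus_lam ext_le_Inl lam_le_iff)
  show ?thesis unfolding emv_lam_def[of "emv_of_mv ext"]
  proof (rule the_equality[where P = "\<lambda>l. least (emv_order (emv_of_mv ext)) l ?S"])
    fix l assume "least (emv_order (emv_of_mv ext)) l ?S"
    with least have l: "l \<in> ?S" "ext_le l (Inl (lam b x))" "ext_le (Inl (lam b x)) l"
      by (auto simp: least_def)
    then obtain z where "l = Inl z" "z \<in> carrier M" unfolding S by blast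
    then show "l = Inl (lam b x)" using l assms by (simp add: ext_le_Inl le_antisym)
  qed (rule least)
qed

lemma Inl_hom: "Inl \<in> emv_hom M (emv_of_mv ext)"
  unfolding emv_hom_def
  by (auto simp: ext_sup_Inl ext_inf_Inl at_least_at_most_def ext_lam_Inl carrier_order)

section \<open>The image as a maximal ideal\<close>

lemma ext_ideal_Inl: "mv_ideal ext (Inl ` carrier M)"
proof -
  have "v \<in> Inl ` carrier M" if "x \<in> carrier M" "v \<in> ext_carrier" "ext_le v (Inl x)" for x v
    using that by (cases v) (auto simp: not_ext_le_Inr_Inl)
  then show ?thesis unfolding mv_ideal_def by auto
qed

lemma ext_maximal_ideal_Inl: "mv_maximal_ideal ext (Inl ` carrier M)"
proof -
  interpret N: mv_algebra ext by (rule ext_mv)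
  have "Inr \<zero> \<in> ext_carrier" "Inr \<zero> \<notin> Inl ` carrier M" by auto
  then have "Inl ` carrier M \<noteq> ext_carrier" by blast
  moreover have "J = Inl ` carrier M"
    if J: "mv_ideal ext J" "J \<noteq> ext_carrier" "Inl ` carrier M \<subseteq> J" for J
  proof (rule ccontr)
    assume "J \<noteq> Inl ` carrier M"
    then obtain u where u: "u \<in> J" "u \<notin> Inl ` carrier M" using J by blast
    have "J \<subseteq> ext_carrier" using J by (simp add: mv_ideal_def)
    have plus_J: "ext_plus v w \<in> J" if "v \<in> J" "w \<in> J" for v w
      using J(1) that by (simp add: mv_ideal_def)
    have down_J: "w \<in> J" if "v \<in> J" "w \<in> ext_carrier" "ext_le w v" for v w
      using J(1) that unfolding mv_ideal_def ext_simps by blast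
    from u \<open>J \<subseteq> ext_carrier\<close> obtain x where x: "u = Inr x" "x \<in> carrier M" by (cases u) auto
    \<comment> \<open>A larger ideal contains some \<open>Inr x\<close> together with
      \<open>Inl x\<close>, and the sum of an element and its complement is the top.\<close>
    then have "ext_plus (Inl x) (Inr x) \<in> J" using J(3) u by (intro plus_J) auto
    moreover have "ext_plus (Inl x) (Inr x) = Inr \<zero>" using N.plus_neg_self[of "Inl x"] x by simp
    ultimately have "Inr \<zero> \<in> J" by simp
    moreover have "ext_le v (Inr \<zero>)" if "v \<in> ext_carrier" for v
      using N.inf_one[of v] that by (simp add: ext_le_iff)
    ultimately have "ext_carrier \<subseteq> J" using down_J by blast
    then show False using J(2) \<open>J \<subseteq> ext_carrier\<close> by blast
  qed
  ultimately show ?thesis using ext_ideal_Inl by (simp add: mv_maximal_ideal_def)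
qed

end

theorem theorem5p21:
  fixes M :: "'a emv"
  assumes "emv_algebra M"
  shows "emv_is_mv M \<or>
    (\<exists>(N :: ('a + 'a) mv) f. mv_algebra N \<and> f \<in> emv_hom M (emv_of_mv N) \<and>
      inj_on f (carrier M) \<and> mv_maximal_ideal N (f ` carrier M))"
proof (cases "\<exists>t. greatest (emv_order M) t (carrier M)")
  case True
  then show ?thesis using emv_algebra.is_mv_if_greatest[OF assms] by blast
next
  case False
  interpret emv_algebra M by (rule assms)
  interpret topless_emv_algebra M
    using False by unfold_locales (auto simp: greatest_def emv_order_def)
  show ?thesis using ext_mv Inl_hom ext_maximal_ideal_Inl inj_Inl by blast
qed

end
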